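(* Let $p\ge 2$, let $m<M$ be reals, $Z=(m,M)^p$, $\hat Z=[m,M]^p$. Let $N\subset Z$ be a finite and stable set and let $\bar z\in Z$ be a point not dominated by any point of $N$, such that no two distinct points of $N\cup\{\bar z\}$ have the same value in any component. Let $\hat N=N\cup\{\hat z^1,\dots,\hat z^p\}$ with $\hat z^j$ having $j$th component $M$ and all other components $m$. For $u\in U(N)$ and $k\in\{1,\dots,p\}$, let $z^k(u)$ be the unique point $z\in\hat N$ with $z_k=u_k$ and $z_{-k}<u_{-k}$. Consider $u\in U(N)$ with $\bar z<u$, and for $j\in\{1,\dots,p\}$ let $z^{\max}_j(u)=\max_{k\neq j} z^k_j(u)$ (the $j$th component of $z^k(u)$). Then for every $j\in\{1,\dots,p\}$, the point $(\bar z_j,u_{-j})$ belongs to $U(N\cup\{\bar z\})$ if and only if $\bar z_j>z^{\max}_j(u)$.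
   Context: For $z^1,z^2\in\mathbb{R}^p$: $z^1\leqq z^2$ means $z^1_j\le z^2_j$ for all $j$; $z^1\leq z^2$ ($z^1$ dominates $z^2$) means $z^1\leqq z^2$ and $z^1\neq z^2$; $z^1<z^2$ means $z^1_j<z^2_j$ for all $j$. A set $N\subset Z$ is stable if $z^1\not\leq z^2$ for all $z^1,z^2\in N$. $z_{-j}$ denotes the $(p-1)$-vector of components of $z$ other than $j$, and $(z_j,a_{-j})$ denotes $(a_1,\dots,a_{j-1},z_j,a_{j+1},\dots,a_p)$. For a finite set $Q\subset Z$, the search region is $S(Q)=\{z\in Z:\ \bar z\not\leqq z \text{ for all } \bar z\in Q\}$; for $u\in\hat Z$, $C(u)=\{z\in Z: z<u\}$. The upper bound set $U(Q)\subset\hat Z$ is the (unique) set satisfying (1) $S(Q)=\bigcup_{u\in U(Q)}C(u)$ and (2) for all $u^1,u^2\in U(Q)$, $C(u^1)$ is not a proper subset of $C(u^2)$. *)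

theory Defs
  imports "HOL-Analysis.Analysis"
begin

text \<open>
  The library order \<open>\<le>\<close> on \<^typ>\<open>real ^ 'n\<close> is the weak componentwise order.
  The library \<open><\<close> is not the strict componentwise order (it is \<open>\<le>\<close> together with \<open>\<noteq>\<close>),
  so the two strict relations get names of their own.
\<close>

definition dominates :: "real ^ 'n \<Rightarrow> real ^ 'n \<Rightarrow> bool" where
  "dominates x y \<longleftrightarrow> x \<le> y \<and> x \<noteq> y"

definition strictly_below :: "real ^ 'n \<Rightarrow> real ^ 'n \<Rightarrow> bool" where
  "strictly_below x y \<longleftrightarrow> (\<forall>i. x $ i < y $ i)"

definition strictly_below_except :: "'n \<Rightarrow> real ^ 'n \<Rightarrow> real ^ 'n \<Rightarrow> bool" where
  "strictly_below_except k x y \<longleftrightarrow> (\<forall>i. i \<noteq> k \<longrightarrow> x $ i < y $ i)"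

definition stable_set :: "(real ^ 'n) set \<Rightarrow> bool" where
  "stable_set N \<longleftrightarrow> (\<forall>x\<in>N. \<forall>y\<in>N. \<not> dominates x y)"

definition open_cube :: "real \<Rightarrow> real \<Rightarrow> (real ^ 'n) set" where
  "open_cube m M = {z. \<forall>i. m < z $ i \<and> z $ i < M}"

definition closed_cube :: "real \<Rightarrow> real \<Rightarrow> (real ^ 'n) set" where
  "closed_cube m M = {z. \<forall>i. m \<le> z $ i \<and> z $ i \<le> M}"

definition search_region :: "real \<Rightarrow> real \<Rightarrow> (real ^ 'n) set \<Rightarrow> (real ^ 'n) set" where
  "search_region m M Q = {z \<in> open_cube m M. \<forall>q\<in>Q. \<not> q \<le> z}"

definition search_zone :: "real \<Rightarrow> real \<Rightarrow> real ^ 'n \<Rightarrow> (real ^ 'n) set" where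
  "search_zone m M u = {z \<in> open_cube m M. strictly_below z u}"

definition is_upper_bound_set ::
    "real \<Rightarrow> real \<Rightarrow> (real ^ 'n) set \<Rightarrow> (real ^ 'n) set \<Rightarrow> bool" where
  "is_upper_bound_set m M Q U \<longleftrightarrow>
     U \<subseteq> closed_cube m M \<and>
     search_region m M Q = (\<Union>u\<in>U. search_zone m M u) \<and>
     (\<forall>u1\<in>U. \<forall>u2\<in>U. \<not> search_zone m M u1 \<subset> search_zone m M u2)"

text \<open>
  For \<open>m < M\<close> and a finite subset \<open>Q\<close> of the open cube, exactly one set satisfies the description.
\<close>

definition upper_bound_set :: "real \<Rightarrow> real \<Rightarrow> (real ^ 'n) set \<Rightarrow> (real ^ 'n) set" where
  "upper_bound_set m M Q = (THE U. is_upper_bound_set m M Q U)"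

definition dummy_point :: "real \<Rightarrow> real \<Rightarrow> 'n \<Rightarrow> real ^ 'n" where
  "dummy_point m M j = (\<chi> i. if i = j then M else m)"

definition with_dummies :: "real \<Rightarrow> real \<Rightarrow> (real ^ 'n) set \<Rightarrow> (real ^ 'n) set" where
  "with_dummies m M N = N \<union> range (dummy_point m M)"

definition defining_point ::
    "real \<Rightarrow> real \<Rightarrow> (real ^ 'n) set \<Rightarrow> real ^ 'n \<Rightarrow> 'n \<Rightarrow> real ^ 'n" where
  "defining_point m M N u k =
     (THE z. z \<in> with_dummies m M N \<and> z $ k = u $ k \<and> strictly_below_except k z u)"

definition z_max :: "real \<Rightarrow> real \<Rightarrow> (real ^ 'n) set \<Rightarrow> real ^ 'n \<Rightarrow> 'n::finite \<Rightarrow> real" where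
  "z_max m M N u j = Max ((\<lambda>k. defining_point m M N u k $ j) ` {k. k \<noteq> j})"

text \<open>\<open>replace_comp j x a\<close> is $(x_j, a_{-j})$.\<close>

definition replace_comp :: "'n \<Rightarrow> real ^ 'n \<Rightarrow> real ^ 'n \<Rightarrow> real ^ 'n" where
  "replace_comp j x a = (\<chi> i. if i = j then x $ i else a $ i)"

end

theory Submission imports Defs begin

text \<open>
  The upper bound set is identified with the set of maximal points \<open>u\<close> of the closed cube for which
  no point of \<open>Q\<close> is strictly below \<open>u\<close>; such a \<open>u\<close> is maximal iff in each direction \<open>j\<close> it is
  blocked, i.e. \<open>u $ j = M\<close> or some point of \<open>Q\<close> agrees with \<open>u\<close> in component \<open>j\<close> and is strictly
  below it elsewhere. After lowering component \<open>j\<close> of \<open>u\<close> to that of \<open>zbar\<close>, direction \<open>j\<close> is blocked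
  by \<open>zbar\<close>, and a direction \<open>k \<noteq> j\<close> stays blocked iff the \<open>j\<close>th component of the defining point
  of \<open>u\<close> for \<open>k\<close> is less than that of \<open>zbar\<close>.
\<close>

text \<open>For \<open>Q\<close> inside the open cube, these are the candidates whose search zone
  stays within the search region.\<close>

definition free_bounds :: "real \<Rightarrow> real \<Rightarrow> (real ^ 'n) set \<Rightarrow> (real ^ 'n) set" where
  "free_bounds m M Q = {u \<in> closed_cube m M. \<forall>q\<in>Q. \<not> strictly_below q u}"

definition maximal_free_bounds :: "real \<Rightarrow> real \<Rightarrow> (real ^ 'n) set \<Rightarrow> (real ^ 'n) set" where
  "maximal_free_bounds m M Q =
     {u \<in> free_bounds m M Q. \<forall>w \<in> free_bounds m M Q. u \<le> w \<longrightarrow> w = u}"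

text \<open>Pushes a bound up onto a finite grid while keeping it free, so that maximal free bounds
  can be found in a finite set.\<close>

definition grid_ceiling :: "real \<Rightarrow> (real ^ 'n) set \<Rightarrow> real ^ 'n \<Rightarrow> real ^ 'n" where
  "grid_ceiling M Q u = (\<chi> i. Min (insert M {q $ i | q. q \<in> Q \<and> u $ i \<le> q $ i}))"

section \<open>Inclusions between search zones\<close>

lemma search_zone_subset_region_iff:
  assumes "Q \<subseteq> open_cube m M"
  shows "search_zone m M u \<subseteq> search_region m M Q \<longleftrightarrow> (\<forall>q\<in>Q. \<not> strictly_below q u)"
proof
  assume "search_zone m M u \<subseteq> search_region m M Q"
  \<comment> \<open>A point \<open>q\<close> of \<open>Q\<close> strictly below \<open>u\<close>
    would itself lie in the zone, but not in the region, since \<open>q \<le> q\<close>.\<close>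
  then show "\<forall>q\<in>Q. \<not> strictly_below q u"
    using assms unfolding search_zone_def search_region_def by blast
next
  assume "\<forall>q\<in>Q. \<not> strictly_below q u"
  then show "search_zone m M u \<subseteq> search_region m M Q"
    unfolding search_zone_def search_region_def strictly_below_def less_eq_vec_def
    by (auto, meson le_less_trans)
qed

lemma search_zone_mono: "u \<le> v \<Longrightarrow> search_zone m M u \<subseteq> search_zone m M v"
  unfolding search_zone_def strictly_below_def less_eq_vec_def
  by (auto, meson less_le_trans)

lemma search_zone_nonempty_iff:
  assumes "u \<in> closed_cube m M"
  shows "search_zone m M u \<noteq> {} \<longleftrightarrow> (\<forall>i. m < u $ i)"
proof
  assume "search_zone m M u \<noteq> {}"
  then show "\<forall>i. m < u $ i"
    unfolding search_zone_def strictly_below_def open_cube_def by (auto, meson less_trans)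
next
  assume *: "\<forall>i. m < u $ i"
  have "m < (m + u $ i) / 2 \<and> (m + u $ i) / 2 < M \<and> (m + u $ i) / 2 < u $ i" for i
    using *[rule_format, of i] assms unfolding closed_cube_def
    by (auto simp: field_simps dest!: spec[of _ i])
  then have "(\<chi> i. (m + u $ i) / 2) \<in> search_zone m M u"
    unfolding search_zone_def strictly_below_def open_cube_def by simp
  then show "search_zone m M u \<noteq> {}" by blast
qed

text \<open>Supplies a test point of the zone so close to \<open>v\<close> that, for
  \<open>f\<close> in \<open>F\<close>, \<open>x $ i < f $ i\<close> already forces
  \<open>v $ i \<le> f $ i\<close>.\<close>

lemma search_zone_approx_from_below:
  assumes "finite F" "v \<in> closed_cube m M" "\<forall>i. m < v $ i"
  obtains x where "x \<in> search_zone m M v" "\<And>f i. f \<in> F \<Longrightarrow> f $ i < v $ i \<Longrightarrow> f $ i \<le> x $ i"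
proof -
  \<comment> \<open>The midpoint keeps \<open>x\<close> above \<open>m\<close> even where no
    component of \<open>F\<close> lies below that of \<open>v\<close>.\<close>
  define G where "G i = insert ((m + v $ i) / 2) {f $ i | f. f \<in> F \<and> f $ i < v $ i}" for i
  define x :: "real ^ 'a" where "x = (\<chi> i. Max (G i))"
  have fin: "finite (G i)" for i
    unfolding G_def using assms(1) by simp
  have ub: "x $ i < v $ i" for i
    unfolding x_def using fin assms(3)[rule_format, of i] by (auto simp: G_def)
  have lb: "(m + v $ i) / 2 \<le> x $ i" for i
    using Max_ge[OF fin, of "(m + v $ i) / 2" i] by (simp add: x_def G_def)
  have "m < x $ i \<and> x $ i < M" for i
    using ub[of i] lb[of i] assms(3)[rule_format, of i] assms(2)
    unfolding closed_cube_def by (auto dest!: spec[of _ i])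
  then have "x \<in> search_zone m M v"
    using ub unfolding search_zone_def open_cube_def strictly_below_def by auto
  moreover have "f $ i \<le> x $ i" if "f \<in> F" "f $ i < v $ i" for f i
    using Max_ge[OF fin, of "f $ i" i] that by (auto simp: x_def G_def)
  ultimately show ?thesis using that by blast
qed

text \<open>The bound \<open>m < u $ i\<close> excludes the empty zone, which is contained in every
  zone. A test point of the zone of \<open>u\<close> chosen with \<open>F = {v}\<close> then detects
  any component in which \<open>v\<close> is smaller.\<close>

lemma search_zone_subset_iff:
  assumes "u \<in> closed_cube m M" "\<forall>i. m < u $ i"
  shows "search_zone m M u \<subseteq> search_zone m M v \<longleftrightarrow> u \<le> v"
proof
  assume sub: "search_zone m M u \<subseteq> search_zone m M v"
  obtain x where x: "x \<in> search_zone m M u" "\<And>f i. f \<in> {v} \<Longrightarrow> f $ i < u $ i \<Longrightarrow> f $ i \<le> x $ i"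
    using search_zone_approx_from_below[of "{v}", OF _ assms] by blast
  have "x $ i < v $ i" for i
    using sub x(1) by (auto simp: search_zone_def strictly_below_def)
  then show "u \<le> v"
    using x(2) unfolding less_eq_vec_def by (metis insertI1 linorder_not_less)
qed (rule search_zone_mono)

section \<open>Existence of maximal free bounds on a finite grid\<close>

context
  fixes m M :: real and Q :: "(real ^ 'n) set"
  assumes less: "m < M" and Q_cube: "Q \<subseteq> open_cube m M" and Q_finite: "finite Q"
begin

lemma grid_ceiling_ge: "u \<in> closed_cube m M \<Longrightarrow> u \<le> grid_ceiling M Q u"
  unfolding less_eq_vec_def grid_ceiling_def closed_cube_def using Q_finite by auto

lemma grid_ceiling_component:
  "grid_ceiling M Q u $ i = M \<or> (\<exists>q\<in>Q. grid_ceiling M Q u $ i = q $ i)"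
proof -
  have "grid_ceiling M Q u $ i \<in> insert M {q $ i | q. q \<in> Q \<and> u $ i \<le> q $ i}"
    unfolding grid_ceiling_def vec_lambda_beta using Q_finite by (intro Min_in) auto
  then show ?thesis by auto
qed

lemma grid_ceiling_gt_m: "m < grid_ceiling M Q u $ i"
  using grid_ceiling_component[of u i] less Q_cube by (auto simp: open_cube_def)

lemma grid_ceiling_free:
  assumes "u \<in> free_bounds m M Q"
  shows "grid_ceiling M Q u \<in> free_bounds m M Q"
proof -
  have "grid_ceiling M Q u \<in> closed_cube m M"
    unfolding closed_cube_def
  proof (intro CollectI allI conjI)
    fix i
    show "m \<le> grid_ceiling M Q u $ i" using grid_ceiling_gt_m by (rule less_imp_le)
    show "grid_ceiling M Q u $ i \<le> M" using Q_finite by (simp add: grid_ceiling_def)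
  qed
  moreover have "strictly_below q u" if "q \<in> Q" "strictly_below q (grid_ceiling M Q u)" for q
    unfolding strictly_below_def
  proof (rule allI, rule ccontr)
    fix i assume "\<not> q $ i < u $ i"
    \<comment> \<open>Here \<open>u $ i \<le> q $ i\<close>, so \<open>q $ i\<close> is one of the
      candidates in the minimum.\<close>
    then have "grid_ceiling M Q u $ i \<le> q $ i"
      unfolding grid_ceiling_def using Q_finite that(1)
      by (auto simp del: Min_insert intro!: Min_le)
    then show False using that(2) unfolding strictly_below_def by (meson not_less)
  qed
  ultimately show ?thesis using assms unfolding free_bounds_def by blast
qed

lemma finite_range_grid_ceiling: "finite (range (grid_ceiling M Q))"
proof -
  let ?G = "insert M (\<Union>i. (\<lambda>q. q $ i) ` Q)"
  have "range (grid_ceiling M Q) \<subseteq> vec_lambda ` (UNIV \<rightarrow>\<^sub>E ?G)"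
  proof
    fix v assume "v \<in> range (grid_ceiling M Q)"
    then have "vec_nth v \<in> UNIV \<rightarrow>\<^sub>E ?G"
      using grid_ceiling_component by (fastforce simp: PiE_def)
    then show "v \<in> vec_lambda ` (UNIV \<rightarrow>\<^sub>E ?G)"
      by (metis image_eqI vec_nth_inverse)
  qed
  moreover have "finite (UNIV \<rightarrow>\<^sub>E ?G :: ('n \<Rightarrow> real) set)"
    using Q_finite by (intro finite_PiE) auto
  ultimately show ?thesis using finite_subset by blast
qed

text \<open>The ceiling is a free bound above \<open>v\<close>, so maximality forces equality.
  Finiteness and components above \<open>m\<close> follow.\<close>

lemma maximal_free_bounds_grid:
  assumes "v \<in> maximal_free_bounds m M Q"
  shows "grid_ceiling M Q v = v"
  using assms grid_ceiling_free grid_ceiling_ge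
  unfolding maximal_free_bounds_def by (auto simp: free_bounds_def)

lemma finite_maximal_free_bounds: "finite (maximal_free_bounds m M Q)"
  using maximal_free_bounds_grid
  by (intro finite_subset[OF _ finite_range_grid_ceiling]) (metis rangeI subsetI)

lemma maximal_free_bounds_gt_m: "v \<in> maximal_free_bounds m M Q \<Longrightarrow> m < v $ i"
  using maximal_free_bounds_grid grid_ceiling_gt_m by metis

lemma maximal_free_bounds_cube: "v \<in> maximal_free_bounds m M Q \<Longrightarrow> v \<in> closed_cube m M"
  unfolding maximal_free_bounds_def free_bounds_def by blast

lemma maximal_free_bounds_above:
  assumes "u \<in> free_bounds m M Q"
  obtains v where "v \<in> maximal_free_bounds m M Q" "u \<le> v"
proof -
  let ?F = "free_bounds m M Q \<inter> range (grid_ceiling M Q)"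
  have "finite ?F" using finite_range_grid_ceiling by simp
  moreover have "grid_ceiling M Q u \<in> ?F" using grid_ceiling_free assms by simp
  ultimately obtain v where v: "v \<in> ?F" "grid_ceiling M Q u \<le> v" "\<forall>b\<in>?F. v \<le> b \<longrightarrow> v = b"
    using finite_has_maximal2[of ?F "grid_ceiling M Q u"] by blast
  \<comment> \<open>Maximality on the grid suffices: a free \<open>w\<close> above \<open>v\<close>
    lies below its own ceiling, which is again free and on the grid.\<close>
  have "w = v" if w: "w \<in> free_bounds m M Q" "v \<le> w" for w
  proof -
    have ge: "w \<le> grid_ceiling M Q w" using w grid_ceiling_ge by (auto simp: free_bounds_def)
    then have "v = grid_ceiling M Q w"
      using v(3) grid_ceiling_free[OF w(1)] w(2) by (meson IntI order_trans rangeI)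
    then show ?thesis using ge w(2) by simp
  qed
  then have "v \<in> maximal_free_bounds m M Q"
    using v(1) unfolding maximal_free_bounds_def by blast
  moreover have "u \<le> v"
    using assms v(2) grid_ceiling_ge[of u] by (auto simp: free_bounds_def)
  ultimately show ?thesis using that by blast
qed

section \<open>Maximality as blocking in every direction\<close>

lemma maximal_free_bounds_iff:
  "v \<in> maximal_free_bounds m M Q \<longleftrightarrow>
     v \<in> free_bounds m M Q \<and>
     (\<forall>j. v $ j = M \<or> (\<exists>q\<in>Q. q $ j = v $ j \<and> strictly_below_except j q v))"
  (is "_ \<longleftrightarrow> _ \<and> ?blocked")
proof (intro iffI conjI allI)
  assume v: "v \<in> maximal_free_bounds m M Q"
  then show free: "v \<in> free_bounds m M Q"
    unfolding maximal_free_bounds_def by blast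
  fix j
  show "v $ j = M \<or> (\<exists>q\<in>Q. q $ j = v $ j \<and> strictly_below_except j q v)"
  proof (rule ccontr)
    assume unblocked: "\<not> ?thesis"
    \<comment> \<open>An unblocked component can be raised to the next value occurring in
      \<open>Q\<close>, or to \<open>M\<close>; no point of \<open>Q\<close> has its component
      \<open>j\<close> strictly between \<open>v $ j\<close> and \<open>Min G\<close>.\<close>
    define G where "G = insert M {q $ j | q. q \<in> Q \<and> v $ j < q $ j}"
    define w :: "real ^ 'n" where "w = (\<chi> i. if i = j then Min G else v $ i)"
    have fin: "finite G" "G \<noteq> {}" unfolding G_def using Q_finite by auto
    have vM: "v $ j < M" using unblocked free
      by (auto simp: free_bounds_def closed_cube_def less_le)
    have gt: "v $ j < Min G"
      using fin vM by (auto simp: G_def)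
    have "Min G \<le> M" using fin by (simp add: G_def)
    then have "w \<in> closed_cube m M"
      using free gt unfolding w_def free_bounds_def closed_cube_def
      by (auto, meson less_imp_le order_trans)
    moreover have "\<not> strictly_below q w" if q: "q \<in> Q" for q
    proof
      assume below: "strictly_below q w"
      then have qw: "q $ i < (if i = j then Min G else v $ i)" for i
        unfolding strictly_below_def w_def by simp
      have except: "strictly_below_except j q v"
        unfolding strictly_below_except_def using qw by metis
      have "q $ j < Min G" using qw[of j] by simp
      then have "q $ j \<notin> G"
        using fin(1) by (meson Min_le not_less)
      then have "q $ j \<le> v $ j"
        using q unfolding G_def by (auto simp: not_less)
      moreover have "q $ j \<noteq> v $ j" using unblocked q except by blast
      ultimately have "strictly_below q v"
        using except unfolding strictly_below_def strictly_below_except_def by (metis less_le)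
      then show False using free q unfolding free_bounds_def by blast
    qed
    ultimately have "w \<in> free_bounds m M Q" unfolding free_bounds_def by blast
    moreover have "v \<le> w" using gt unfolding less_eq_vec_def w_def by simp
    ultimately have "w = v" using v unfolding maximal_free_bounds_def by blast
    moreover have "w $ j = Min G" by (simp add: w_def)
    ultimately show False using gt by simp
  qed
next
  assume v: "v \<in> free_bounds m M Q \<and> ?blocked"
  have "w = v" if w: "w \<in> free_bounds m M Q" "v \<le> w" for w
  proof (rule ccontr)
    assume "w \<noteq> v"
    then obtain j where j: "v $ j < w $ j"
      using w(2) unfolding less_eq_vec_def vec_eq_iff by (metis less_le)
    then have "v $ j \<noteq> M"
      using w(1) unfolding free_bounds_def closed_cube_def by (auto dest: leD)
    then obtain q where q: "q \<in> Q" "q $ j = v $ j" "strictly_below_except j q v"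
      using v by blast
    \<comment> \<open>Any increase in direction \<open>j\<close> puts the blocking point strictly
      below the new bound.\<close>
    then have "strictly_below q w"
      using j w(2) unfolding strictly_below_def strictly_below_except_def less_eq_vec_def
      by (metis less_le_trans)
    then show False using w(1) q(1) unfolding free_bounds_def by blast
  qed
  then show "v \<in> maximal_free_bounds m M Q"
    using v unfolding maximal_free_bounds_def by blast
qed

lemma search_region_below_free_bound:
  assumes "z \<in> search_region m M Q"
  obtains u where "u \<in> free_bounds m M Q" "strictly_below z u"
proof -
  have z: "z \<in> open_cube m M" "\<And>q. q \<in> Q \<Longrightarrow> \<not> q \<le> z"
    using assms unfolding search_region_def by auto
  \<comment> \<open>Unlike in \<open>grid_ceiling\<close> the inequality is strict, so
    \<open>u\<close> ends up strictly above \<open>z\<close>. A point of \<open>Q\<close> strictly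
    below \<open>u\<close> would then be weakly below \<open>z\<close>.\<close>
  define G where "G i = insert M {q $ i | q. q \<in> Q \<and> z $ i < q $ i}" for i
  define u :: "real ^ 'n" where "u = (\<chi> i. Min (G i))"
  have fin: "finite (G i)" "G i \<noteq> {}" for i unfolding G_def using Q_finite by auto
  have gt: "z $ i < u $ i" for i
    using fin z(1) by (auto simp: u_def G_def open_cube_def)
  have le: "u $ i \<le> M" for i
    using fin by (auto simp: u_def G_def)
  have "m \<le> u $ i" for i
    using gt[of i] z(1) by (auto simp: open_cube_def dest!: spec[of _ i])
  moreover have "\<not> strictly_below q u" if q: "q \<in> Q" for q
  proof
    assume "strictly_below q u"
    then have "q $ i < Min (G i)" for i
      unfolding strictly_below_def u_def by simp
    then have "q $ i \<notin> G i" for i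
      using fin[of i] by (meson Min_le not_less)
    then have "\<not> z $ i < q $ i" for i
      using q unfolding G_def by blast
    then show False using z(2)[OF q] unfolding less_eq_vec_def by (meson not_less)
  qed
  ultimately have "u \<in> free_bounds m M Q"
    using le unfolding free_bounds_def closed_cube_def by blast
  then show ?thesis using gt that unfolding strictly_below_def by blast
qed

section \<open>Existence and uniqueness of the upper bound set\<close>

lemma is_upper_bound_set_maximal_free_bounds:
  "is_upper_bound_set m M Q (maximal_free_bounds m M Q)"
  unfolding is_upper_bound_set_def
proof (intro conjI ballI)
  let ?V = "maximal_free_bounds m M Q"
  show "?V \<subseteq> closed_cube m M" using maximal_free_bounds_cube by blast
  show "search_region m M Q = (\<Union>u\<in>?V. search_zone m M u)"
  proof
    show "(\<Union>u\<in>?V. search_zone m M u) \<subseteq> search_region m M Q"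
      using search_zone_subset_region_iff[OF Q_cube]
      unfolding maximal_free_bounds_def free_bounds_def by blast
    show "search_region m M Q \<subseteq> (\<Union>u\<in>?V. search_zone m M u)"
    proof
      fix z assume z: "z \<in> search_region m M Q"
      then obtain u where u: "u \<in> free_bounds m M Q" "strictly_below z u"
        using search_region_below_free_bound by blast
      obtain v where v: "v \<in> ?V" "u \<le> v" using maximal_free_bounds_above u(1) by blast
      have "z \<in> search_zone m M u"
        using z u(2) unfolding search_zone_def search_region_def by blast
      then show "z \<in> (\<Union>u\<in>?V. search_zone m M u)"
        using search_zone_mono[OF v(2)] v(1) by blast
    qed
  qed
  fix u v assume uv: "u \<in> ?V" "v \<in> ?V"
  show "\<not> search_zone m M u \<subset> search_zone m M v"
  proof
    assume sub: "search_zone m M u \<subset> search_zone m M v"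
    then have "u \<le> v"
      using search_zone_subset_iff maximal_free_bounds_cube maximal_free_bounds_gt_m uv
      by blast
    then have "u = v" using uv unfolding maximal_free_bounds_def by blast
    then show False using sub by blast
  qed
qed

lemma is_upper_bound_set_unique:
  assumes U: "is_upper_bound_set m M Q U"
  shows "U = maximal_free_bounds m M Q"
proof -
  let ?V = "maximal_free_bounds m M Q"
  have cube: "w \<in> closed_cube m M" if "w \<in> U" for w
    using U that unfolding is_upper_bound_set_def by blast
  have region: "search_region m M Q = (\<Union>u\<in>U. search_zone m M u)"
    using U unfolding is_upper_bound_set_def by blast
  have anti: "\<not> search_zone m M w \<subset> search_zone m M w'" if "w \<in> U" "w' \<in> U" for w w'
    using U that unfolding is_upper_bound_set_def by blast
  have region_V: "search_region m M Q = (\<Union>u\<in>?V. search_zone m M u)"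
    using is_upper_bound_set_maximal_free_bounds unfolding is_upper_bound_set_def by blast
  have free: "w \<in> free_bounds m M Q" if "w \<in> U" for w
    using search_zone_subset_region_iff[OF Q_cube] region that cube
    unfolding free_bounds_def by blast
  \<comment> \<open>The constant bound \<open>m\<close> lies below some maximal bound, whose
    nonempty zone shows that the search region is nonempty.\<close>
  have "(\<chi> i. m) \<in> free_bounds m M Q"
    using less Q_cube unfolding free_bounds_def closed_cube_def open_cube_def strictly_below_def
    by (auto simp: not_less less_imp_le subset_iff)
  then obtain v0 where "v0 \<in> ?V" using maximal_free_bounds_above by blast
  then have "search_region m M Q \<noteq> {}"
    using region_V search_zone_nonempty_iff maximal_free_bounds_cube maximal_free_bounds_gt_m
    by fastforce
  then obtain w0 where "w0 \<in> U" "search_zone m M w0 \<noteq> {}"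
    using region by blast
  \<comment> \<open>Otherwise the zone of \<open>w\<close> would be empty and hence a proper subset
    of that of \<open>w0\<close>.\<close>
  then have gt: "\<forall>i. m < w $ i" if "w \<in> U" for w
    using anti[OF that, of w0] search_zone_nonempty_iff[OF cube[OF that]] by blast
  have antichain: "w = w'" if "w \<in> U" "w' \<in> U" "w \<le> w'" for w w'
  proof -
    have "search_zone m M w' \<subseteq> search_zone m M w"
      using anti that search_zone_mono by blast
    then have "w' \<le> w" using search_zone_subset_iff cube gt that by blast
    then show ?thesis using that by simp
  qed
  have VU: "v \<in> U" if v: "v \<in> ?V" for v
  proof -
    \<comment> \<open>\<open>U\<close> may a priori be infinite. Points of \<open>U\<close> below \<open>v\<close> are therefore sorted into finitely many
      classes according to the components where they agree with \<open>v\<close>; a point of \<open>U\<close> close enough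
      to \<open>v\<close> is above the representative of its class, contradicting the antichain property
      unless it is \<open>v\<close> itself.\<close>
    define P where "P I w \<longleftrightarrow> w \<in> U \<and> w \<le> v \<and> I = {i. w $ i = v $ i}" for I w
    define r where "r I = (SOME w. P I w)" for I
    \<comment> \<open>\<open>range r\<close> is finite because its indices are subsets of a finite
      type. Including \<open>?V\<close> ensures that a maximal bound strictly above \<open>x\<close>
      is above \<open>v\<close>, hence equal to \<open>v\<close>.\<close>
    have "finite (?V \<union> range r)" using finite_maximal_free_bounds by simp
    then obtain x where x: "x \<in> search_zone m M v"
      "\<And>f i. f \<in> ?V \<union> range r \<Longrightarrow> f $ i < v $ i \<Longrightarrow> f $ i \<le> x $ i"
      using search_zone_approx_from_below maximal_free_bounds_cube[OF v]
        maximal_free_bounds_gt_m[OF v] by metis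
    have "x \<in> search_region m M Q" using x(1) region_V v by blast
    then obtain w where w: "w \<in> U" "x \<in> search_zone m M w" using region by blast
    obtain v' where v': "v' \<in> ?V" "w \<le> v'" using maximal_free_bounds_above free w(1) by blast
    have xw: "x $ i < w $ i" for i
      using w(2) unfolding search_zone_def strictly_below_def by blast
    have "x $ i < v' $ i" for i
      using xw v'(2) unfolding less_eq_vec_def by (meson less_le_trans)
    then have "v \<le> v'"
      using x(2)[of v'] v'(1) unfolding less_eq_vec_def by (meson UnI1 not_less)
    then have "v' = v" using v v'(1) unfolding maximal_free_bounds_def by blast
    then have wv: "w \<le> v" using v'(2) by simp
    define I where "I = {i. w $ i = v $ i}"
    have "P I w" unfolding P_def I_def using w(1) wv by simp
    then have r: "P I (r I)" unfolding r_def by (rule someI)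
    have off: "r I $ i < w $ i" if "i \<notin> I" for i
    proof -
      have "r I $ i < v $ i"
        using r that unfolding P_def less_eq_vec_def by (auto simp: less_le)
      then show ?thesis using x(2)[of "r I" i] xw[of i] by simp
    qed
    have on: "r I $ i = w $ i" if "i \<in> I" for i
      using r that unfolding P_def I_def by auto
    have "r I \<le> w"
      unfolding less_eq_vec_def using off on by (metis less_imp_le order_refl)
    then have "r I = w" using antichain r w(1) unfolding P_def by blast
    \<comment> \<open>With \<open>r I = w\<close>, an index outside \<open>I\<close> would give
      \<open>w $ i < w $ i\<close>.\<close>
    then have "I = UNIV" using off by force
    then have "w = v" unfolding I_def vec_eq_iff by blast
    then show ?thesis using w(1) by simp
  qed
  moreover have "w \<in> ?V" if w: "w \<in> U" for w
  proof -
    obtain v where v: "v \<in> ?V" "w \<le> v" using maximal_free_bounds_above free w by blast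
    then have "w = v" using antichain[OF w VU] by blast
    then show ?thesis using v(1) by simp
  qed
  ultimately show ?thesis by blast
qed

lemma upper_bound_set_eq: "upper_bound_set m M Q = maximal_free_bounds m M Q"
  unfolding upper_bound_set_def
  using is_upper_bound_set_maximal_free_bounds is_upper_bound_set_unique by (rule the_equality)

section \<open>Defining points of an upper bound\<close>

lemma defining_point_properties:
  assumes distinct: "\<forall>x\<in>Q. \<forall>y\<in>Q. x \<noteq> y \<longrightarrow> (\<forall>i. x $ i \<noteq> y $ i)"
    and u: "u \<in> upper_bound_set m M Q"
  shows "u $ k = M \<Longrightarrow> defining_point m M Q u k = dummy_point m M k"
    and "q \<in> Q \<Longrightarrow> q $ k = u $ k \<Longrightarrow> strictly_below_except k q u \<Longrightarrow>
         defining_point m M Q u k = q"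
proof -
  have gt: "m < u $ i" for i
    using u maximal_free_bounds_gt_m unfolding upper_bound_set_eq by blast
  {
    \<comment> \<open>Points of \<open>Q\<close> stay below \<open>M\<close>, and every other dummy
      has \<open>m\<close> in component \<open>k\<close>.\<close>
    assume "u $ k = M"
    moreover have "z $ k \<noteq> M" if "z \<in> Q" for z
      using that Q_cube unfolding open_cube_def by (auto simp: less_le subset_iff)
    ultimately show "defining_point m M Q u k = dummy_point m M k"
      unfolding defining_point_def with_dummies_def
      using gt less
      by (intro the_equality)
        (auto simp: dummy_point_def strictly_below_except_def split: if_splits)
  next
    assume q: "q \<in> Q" "q $ k = u $ k" "strictly_below_except k q u"
    have "m < u $ k" "u $ k < M"
      using q(1) Q_cube unfolding q(2)[symmetric] open_cube_def by auto
    \<comment> \<open>A dummy has only the values \<open>m\<close> and \<open>M\<close>, while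
      \<open>u $ k\<close> lies strictly between them.\<close>
    then have "z \<notin> range (dummy_point m M)" if "z $ k = u $ k" for z
      using that by (auto simp: dummy_point_def split: if_splits)
    then have "z = q" if "z \<in> with_dummies m M Q" "z $ k = u $ k" for z
      using that q(1,2) distinct unfolding with_dummies_def by (metis UnE)
    then show "defining_point m M Q u k = q"
      unfolding defining_point_def using q by (intro the_equality) (auto simp: with_dummies_def)
  }
qed

end

section \<open>Lowering one component of an upper bound\<close>

theorem theorem1:
  fixes m M :: real and N :: "(real ^ 'n) set" and zbar u :: "real ^ 'n"
  assumes "CARD('n) \<ge> 2"
    and "m < M"
    and "N \<subseteq> open_cube m M"
    and "finite N"
    and "stable_set N"
    and "zbar \<in> open_cube m M"
    and "\<forall>z\<in>N. \<not> dominates z zbar"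
    and "\<forall>x\<in>N \<union> {zbar}. \<forall>y\<in>N \<union> {zbar}. x \<noteq> y \<longrightarrow> (\<forall>i. x $ i \<noteq> y $ i)"
    and "u \<in> upper_bound_set m M N"
    and "strictly_below zbar u"
  shows "\<forall>j. replace_comp j zbar u \<in> upper_bound_set m M (N \<union> {zbar})
           \<longleftrightarrow> zbar $ j > z_max m M N u j"
proof
  fix j
  let ?u = "replace_comp j zbar u"
  let ?N = "N \<union> {zbar}"
  let ?d = "defining_point m M N u"
  note N = assms(2-4)
  have N': "?N \<subseteq> open_cube m M" "finite ?N" using assms by auto
  have zbar: "m < zbar $ i" "zbar $ i < u $ i" for i
    using assms unfolding open_cube_def strictly_below_def by auto
  have u: "u \<in> free_bounds m M N"
    "\<And>k. u $ k = M \<or> (\<exists>q\<in>N. q $ k = u $ k \<and> strictly_below_except k q u)"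
    using assms(9) unfolding upper_bound_set_eq[OF N] maximal_free_bounds_iff[OF N] by blast+
  have nth: "?u $ i = (if i = j then zbar $ j else u $ i)" for i
    unfolding replace_comp_def by simp
  have dist: "\<forall>x\<in>N. \<forall>y\<in>N. x \<noteq> y \<longrightarrow> (\<forall>i. x $ i \<noteq> y $ i)" using assms(8) by blast
  note d = defining_point_properties[OF N dist assms(9)]

  have "?u \<in> closed_cube m M"
    using u(1) assms(6) unfolding free_bounds_def closed_cube_def open_cube_def
    by (auto simp: nth less_imp_le)
  moreover have "\<not> strictly_below q ?u" if "q \<in> ?N" for q
  proof
    assume below: "strictly_below q ?u"
    \<comment> \<open>\<open>zbar\<close> agrees with \<open>?u\<close> in component
      \<open>j\<close>; any other point would already be strictly below \<open>u\<close>.\<close>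
    then have "q \<noteq> zbar" unfolding strictly_below_def by (metis nth less_irrefl)
    moreover have "strictly_below q u"
      using below zbar(2) unfolding strictly_below_def by (metis nth less_trans)
    ultimately show False using u(1) that unfolding free_bounds_def by blast
  qed
  ultimately have free: "?u \<in> free_bounds m M ?N" unfolding free_bounds_def by blast

  have j_blocked: "zbar $ j = ?u $ j \<and> strictly_below_except j zbar ?u"
    unfolding strictly_below_except_def using zbar(2) by (simp add: nth)
  have k_blocked: "(?u $ k = M \<or> (\<exists>q\<in>?N. q $ k = ?u $ k \<and> strictly_below_except k q ?u))
      \<longleftrightarrow> ?d k $ j < zbar $ j" if k: "k \<noteq> j" for k
  proof (cases "u $ k = M")
    case True
    \<comment> \<open>Both sides hold: the defining point is the dummy for \<open>k\<close>, whose
      component \<open>j\<close> is \<open>m\<close>.\<close>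
    then show ?thesis using k d(1) zbar(1) by (simp add: nth dummy_point_def)
  next
    case False
    then obtain q where q: "q \<in> N" "q $ k = u $ k" "strictly_below_except k q u"
      using u(2) by blast
    \<comment> \<open>No new blocking point can appear in direction \<open>k\<close>:
      \<open>zbar $ k < u $ k\<close> rules out \<open>zbar\<close>, and distinct component values
      rule out the rest of \<open>N\<close>.\<close>
    have "q' = q" if "q' \<in> ?N" "q' $ k = ?u $ k" for q'
    proof -
      have "q' $ k = q $ k" "q' \<noteq> zbar" using that q zbar(2)[of k] k by (auto simp: nth)
      then show ?thesis using that q(1) dist by blast
    qed
    then have "(\<exists>q\<in>?N. q $ k = ?u $ k \<and> strictly_below_except k q ?u)
        \<longleftrightarrow> strictly_below_except k q ?u"
      using q k by (metis UnI1 nth)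
    \<comment> \<open>Lowering changed only component \<open>j\<close>, so this is the only
      comparison that can fail.\<close>
    also have "\<dots> \<longleftrightarrow> q $ j < zbar $ j"
      using q(3) k unfolding strictly_below_except_def by (auto simp: nth)
    finally show ?thesis using False k d(2)[OF q] by (simp add: nth)
  qed

  \<comment> \<open>With at least two components, the maximum in \<open>z_max\<close> is over a
    nonempty set.\<close>
  have ne: "{k. k \<noteq> j} \<noteq> {}"
  proof
    assume "{k. k \<noteq> j} = {}"
    then have "UNIV = {j}" by auto
    then have "CARD('n) = card {j}" by simp
    then show False using assms(1) by simp
  qed
  have "?u \<in> upper_bound_set m M ?N \<longleftrightarrow> (\<forall>k. k \<noteq> j \<longrightarrow> ?d k $ j < zbar $ j)"
    unfolding upper_bound_set_eq[OF assms(2) N'] maximal_free_bounds_iff[OF assms(2) N']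
    using free j_blocked k_blocked by (metis UnI2 singletonI)
  also have "\<dots> \<longleftrightarrow> z_max m M N u j < zbar $ j"
    unfolding z_max_def using ne by (subst Max_less_iff) auto
  finally show "?u \<in> upper_bound_set m M ?N \<longleftrightarrow> zbar $ j > z_max m M N u j" .
qed

end
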